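(* Let $X$ and $Y$ be paracompact Hausdorff spaces and let $f\colon X\to Y$ be a continuous map all of whose fibers $f^{-1}(y)$, $y\in Y$, are compact, and such that $W(f)\leq\aleph_0$. If $M$ is a compact metrizable Krasinkiewicz space, then $C(X,M)$ equipped with the uniform convergence topology contains a dense subset of maps $g$ such that for every $y\in Y$ the restriction $g|f^{-1}(y)\colon f^{-1}(y)\to M$ is a Krasinkiewicz map.
   Context: All maps are continuous, and $C(X,M)$ denotes the set of all continuous maps from $X$ to $M$. For a compact metrizable space $M$, the uniform convergence topology on $C(X,M)$ is the topology generated by the metric $\sup_{x\in X} d(g(x),h(x))$, where $d$ is any metric on $M$ compatible with its topology. The spaces $X$ and $Y$ are paracompact Hausdorff and need not be metrizable. $W(f)\leq\aleph_0$ means that there exists a continuous map $g\colon X\to\mathbb{I}^{\aleph_0}$ into the Hilbert cube $\mathbb{I}^{\aleph_0}=[0,1]^{\aleph_0}$ such that the diagonal map $f\triangle g\colon X\to Y\times\mathbb{I}^{\aleph_0}$, $x\mapsto (f(x),g(x))$, is a topological embedding. A compactum means a compact metrizable space, and a continuum is a connected compactum. A map $g\colon K\to M$ with $K$ compact is a Krasinkiewicz map if every continuum in $K$ is either contained in a fiber of $g$ or contains a connected component of a fiber of $g$. A metrizable space $M$ is a Krasinkiewicz space if for every compactum $K$ the function space $C(K,M)$, with the uniform convergence topology, contains a dense subset consisting of Krasinkiewicz maps. *)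

theory Defs
  imports "HOL-Analysis.Analysis"
begin

definition paracompact_space :: "'a topology \<Rightarrow> bool" where
  "paracompact_space X \<longleftrightarrow>
     (\<forall>\<U>. (\<forall>U\<in>\<U>. openin X U) \<and> \<Union>\<U> = topspace X \<longrightarrow>
        (\<exists>\<V>. (\<forall>V\<in>\<V>. openin X V) \<and> \<Union>\<V> = topspace X \<and>
             (\<forall>V\<in>\<V>. \<exists>U\<in>\<U>. V \<subseteq> U) \<and> locally_finite_in X \<V>))"

definition fiber :: "'a topology \<Rightarrow> ('a \<Rightarrow> 'b) \<Rightarrow> 'b \<Rightarrow> 'a set" where
  "fiber X f y = {x \<in> topspace X. f x = y}"

definition hilbert_cube :: "(nat \<Rightarrow> real) topology" where
  "hilbert_cube = product_topology (\<lambda>_. top_of_set {0..1}) UNIV"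

definition W_le_aleph0 :: "'a topology \<Rightarrow> 'b topology \<Rightarrow> ('a \<Rightarrow> 'b) \<Rightarrow> bool" where
  "W_le_aleph0 X Y f \<longleftrightarrow>
     (\<exists>g. continuous_map X hilbert_cube g \<and>
          embedding_map X (prod_topology Y hilbert_cube) (\<lambda>x. (f x, g x)))"

definition compactum :: "'a topology \<Rightarrow> bool" where
  "compactum K \<longleftrightarrow> compact_space K \<and> metrizable_space K"

definition continuum_in :: "'a topology \<Rightarrow> 'a set \<Rightarrow> bool" where
  "continuum_in X C \<longleftrightarrow>
     C \<subseteq> topspace X \<and> C \<noteq> {} \<and> compactum (subtopology X C) \<and> connectedin X C"

definition krasinkiewicz_map :: "'a topology \<Rightarrow> 'b topology \<Rightarrow> ('a \<Rightarrow> 'b) \<Rightarrow> bool" where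
  "krasinkiewicz_map K M g \<longleftrightarrow>
     compact_space K \<and> continuous_map K M g \<and>
     (\<forall>C. continuum_in K C \<longrightarrow>
        (\<exists>y\<in>topspace M. C \<subseteq> fiber K g y) \<or>
        (\<exists>y\<in>topspace M. \<exists>D \<in> connected_components_of (subtopology K (fiber K g y)). D \<subseteq> C))"

text \<open>
  The carrier of \<^const>\<open>cfunspace\<close> consists of the continuous maps with bounded image,
  normalised to be \<^const>\<open>undefined\<close> off \<open>topspace X\<close>; its metric is the supremum metric.
  When \<open>X\<close> or \<open>M\<close> is compact, boundedness is automatic and the choice of the
  compatible metric is irrelevant: see \<open>topspace_uniform_topology\<close> and
  \<open>uniform_topology_eq\<close> below.
\<close>

definition uniform_topology :: "'a topology \<Rightarrow> 'b topology \<Rightarrow> ('a \<Rightarrow> 'b) topology" where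
  "uniform_topology X M = mtopology_of (cfunspace X (SOME m. mtopology_of m = M))"

definition dense_subset :: "'a topology \<Rightarrow> 'a set \<Rightarrow> bool" where
  "dense_subset T D \<longleftrightarrow> D \<subseteq> topspace T \<and> T closure_of D = topspace T"

text \<open>
  The type of \<open>K\<close> is no restriction: every compactum is homeomorphic to a subspace of the
  Hilbert cube (see
  \<open>compactum_homeomorphic_to_subspace_of_hilbert_cube\<close> below), and the condition on \<open>K\<close> is
  invariant under homeomorphisms.
\<close>

definition krasinkiewicz_space :: "'b topology \<Rightarrow> bool" where
  "krasinkiewicz_space M \<longleftrightarrow>
     metrizable_space M \<and>
     (\<forall>K :: (nat \<Rightarrow> real) topology. compactum K \<longrightarrow>
        (\<exists>D. dense_subset (uniform_topology K M) D \<and> (\<forall>g\<in>D. krasinkiewicz_map K M g)))"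

lemma mspace_cfunspace_compact:
  assumes "mtopology_of m = M" and "compact_space X \<or> compact_space M"
  shows "mspace (cfunspace X m) = {f. continuous_map X M f \<and> f \<in> extensional (topspace X)}"
proof -
  interpret m: Metric_space "mspace m" "mdist m" by simp
  have M: "m.mtopology = M" using assms(1) by (simp add: mtopology_of_def)
  have "m.mbounded (f ` topspace X)" if f: "continuous_map X M f" for f
    using assms(2)
  proof
    assume "compact_space X"
    then have "compactin M (f ` topspace X)"
      using f by (simp add: compact_space_def image_compactin)
    then show ?thesis using M m.compactin_imp_mbounded by blast
  next
    assume "compact_space M"
    then have "m.mbounded (topspace M)"
      using M m.compactin_imp_mbounded by (simp add: compact_space_def)
    moreover have "f ` topspace X \<subseteq> topspace M"
      using f by (simp add: continuous_map_image_subset_topspace)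
    ultimately show ?thesis using m.mbounded_subset by blast
  qed
  then show ?thesis
    using assms(1) by (auto simp: continuous_map_def)
qed

lemma compatible_metrics_near_compact:
  assumes eq: "mtopology_of m = mtopology_of m'"
    and K: "compactin (mtopology_of m) K" and "e > 0"
  obtains \<delta> where "\<delta> > 0"
    "\<And>x y. \<lbrakk>x \<in> K; y \<in> mspace m; mdist m x y < \<delta>\<rbrakk> \<Longrightarrow> mdist m' x y < e"
proof -
  interpret m: Metric_space "mspace m" "mdist m" by simp
  interpret m': Metric_space "mspace m'" "mdist m'" by simp
  have T: "m.mtopology = m'.mtopology" using eq by (simp add: mtopology_of_def)
  have sp: "mspace m' = mspace m" using eq by (metis topspace_mtopology_of)
  have Ksub: "K \<subseteq> mspace m" using K compactin_subset_topspace by fastforce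
  have "\<exists>r>0. m.mball z r \<subseteq> m'.mball z (e/2)" if "z \<in> K" for z
  proof -
    have "openin m.mtopology (m'.mball z (e/2))" by (simp add: T)
    moreover have "z \<in> mspace m'" using that Ksub sp by blast
    then have "z \<in> m'.mball z (e/2)" using \<open>e > 0\<close> by simp
    ultimately show ?thesis using m.openin_mtopology by blast
  qed
  then obtain r where r: "\<And>z. z \<in> K \<Longrightarrow> r z > 0 \<and> m.mball z (r z) \<subseteq> m'.mball z (e/2)"
    by metis
  have "compactin m.mtopology K" using K by (simp add: mtopology_of_def)
  moreover have "K \<subseteq> \<Union>((\<lambda>z. m.mball z (r z / 2)) ` K)"
    using r Ksub by fastforce
  moreover have "\<And>U. U \<in> (\<lambda>z. m.mball z (r z / 2)) ` K \<Longrightarrow> openin m.mtopology U" by auto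
  ultimately obtain \<F> where \<F>: "finite \<F>" "\<F> \<subseteq> (\<lambda>z. m.mball z (r z / 2)) ` K" "K \<subseteq> \<Union>\<F>"
    unfolding compactin_def by meson
  obtain F where "F \<subseteq> K" "finite F" "\<F> = (\<lambda>z. m.mball z (r z / 2)) ` F"
    using finite_subset_image[OF \<F>(1,2)] by blast
  then have F: "finite F" "F \<subseteq> K" "K \<subseteq> (\<Union>z\<in>F. m.mball z (r z / 2))"
    using \<F>(3) by simp_all
  define \<delta> where "\<delta> = Min (insert 1 ((\<lambda>z. r z / 2) ` F))"
  have "\<delta> > 0" using F r by (auto simp: \<delta>_def)
  moreover have "mdist m' x y < e" if xy: "x \<in> K" "y \<in> mspace m" "mdist m x y < \<delta>" for x y
  proof -
    obtain z where z: "z \<in> F" "x \<in> m.mball z (r z / 2)" using F xy by blast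
    have "\<delta> \<le> r z / 2" unfolding \<delta>_def using F z by (intro Min_le) auto
    moreover have "r z > 0" using r z F by blast
    ultimately have "x \<in> m.mball z (r z)" "y \<in> m.mball z (r z)"
      using z xy m.triangle[of z x y] by auto
    then have "x \<in> m'.mball z (e/2)" "y \<in> m'.mball z (e/2)" using r z F by blast+
    then show ?thesis
      using m'.triangle[of x z y] m'.commute[of x z] by auto
  qed
  ultimately show ?thesis using that by blast
qed

lemma mtopology_of_cfunspace_le:
  assumes m: "mtopology_of m = M" and m': "mtopology_of m' = M"
    and cpt: "compact_space X \<or> compact_space M"
    and U: "openin (mtopology_of (cfunspace X m')) U"
  shows "openin (mtopology_of (cfunspace X m)) U"
proof -
  let ?P = "cfunspace X m" and ?Q = "cfunspace X m'"
  interpret P: Metric_space "mspace ?P" "mdist ?P" by blast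
  interpret Q: Metric_space "mspace ?Q" "mdist ?Q" by blast
  have sp: "mspace ?Q = mspace ?P"
    by (simp only: mspace_cfunspace_compact[OF m cpt] mspace_cfunspace_compact[OF m' cpt])
  have "\<exists>\<delta>>0. \<forall>h\<in>mspace ?P. mdist ?P f h < \<delta> \<longrightarrow> mdist ?Q f h < e"
    if f: "f \<in> mspace ?P" and "e > 0" for f e
  proof -
    have contf: "continuous_map X M f" using f m by simp
    obtain K where K: "compactin M K" "f ` topspace X \<subseteq> K"
      using cpt
    proof
      assume "compact_space X"
      then show ?thesis using that image_compactin[OF _ contf] unfolding compact_space_def by blast
    next
      assume "compact_space M"
      then show ?thesis
        using that contf unfolding compact_space_def
        by (meson continuous_map_image_subset_topspace)
    qed
    have "e/2 > 0" "mtopology_of m = mtopology_of m'" "compactin (mtopology_of m) K"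
      using \<open>e > 0\<close> m m' K by auto
    then obtain \<delta> where \<delta>: "\<delta> > 0"
      "\<And>x y. \<lbrakk>x \<in> K; y \<in> mspace m; mdist m x y < \<delta>\<rbrakk> \<Longrightarrow> mdist m' x y < e/2"
      using compatible_metrics_near_compact by metis
    have "mdist ?Q f h < e" if h: "h \<in> mspace ?P" "mdist ?P f h < \<delta>" for h
    proof -
      have "mdist m' (f x) (h x) \<le> e/2" if x: "x \<in> topspace X" for x
      proof -
        have "mdist m (f x) (h x) \<le> mdist ?P f h"
          using f h x by (intro mdist_cfunspace_imp_mdist_le[of f X m h]) auto
        moreover have "h x \<in> mspace m" using h x by auto
        ultimately show ?thesis using \<delta>(2)[of "f x" "h x"] h K x by fastforce
      qed
      then have "mdist ?Q f h \<le> e/2" using \<open>e > 0\<close> by (intro mdist_cfunspace_le) auto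
      then show ?thesis using \<open>e > 0\<close> by linarith
    qed
    then show ?thesis using \<delta> by blast
  qed
  note near = this
  have "U \<subseteq> mspace ?P" using U sp by (metis openin_subset topspace_mtopology_of)
  moreover have "\<exists>r>0. P.mball f r \<subseteq> U" if fU: "f \<in> U" for f
  proof -
    obtain e where e: "e > 0" "Q.mball f e \<subseteq> U"
      using U fU unfolding mtopology_of_def Q.openin_mtopology by blast
    have f: "f \<in> mspace ?P" using fU \<open>U \<subseteq> mspace ?P\<close> by blast
    obtain \<delta> where \<delta>: "\<delta> > 0" "\<forall>h\<in>mspace ?P. mdist ?P f h < \<delta> \<longrightarrow> mdist ?Q f h < e"
      using near[OF f e(1)] by blast
    have "P.mball f \<delta> \<subseteq> Q.mball f e"
    proof
      fix h assume "h \<in> P.mball f \<delta>"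
      then have h: "h \<in> mspace ?P" "mdist ?P f h < \<delta>" unfolding P.in_mball by simp_all
      have "f \<in> mspace ?Q" "h \<in> mspace ?Q" using f h(1) by (simp_all only: sp)
      moreover have "mdist ?Q f h < e" using \<delta>(2) h by blast
      ultimately show "h \<in> Q.mball f e" unfolding Q.in_mball by (intro conjI)
    qed
    then show ?thesis using \<delta> e by blast
  qed
  ultimately show ?thesis unfolding mtopology_of_def P.openin_mtopology by blast
qed

lemma uniform_topology_eq:
  assumes "mtopology_of m = M" and "compact_space X \<or> compact_space M"
  shows "uniform_topology X M = mtopology_of (cfunspace X m)"
proof -
  let ?m = "SOME m. mtopology_of m = M"
  have m: "mtopology_of ?m = M" using assms(1) by (rule someI)
  have "openin (mtopology_of (cfunspace X ?m)) U = openin (mtopology_of (cfunspace X m)) U" for U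
    using mtopology_of_cfunspace_le[OF m assms(1,2)] mtopology_of_cfunspace_le[OF assms(1) m assms(2)]
    by (rule iffI[rotated])
  then show ?thesis
    by (simp only: uniform_topology_def topology_eq simp_thms)
qed

lemma topspace_uniform_topology:
  assumes "metrizable_space M" and "compact_space X \<or> compact_space M"
  shows "topspace (uniform_topology X M) = {f. continuous_map X M f \<and> f \<in> extensional (topspace X)}"
proof -
  obtain B d where "Metric_space B d" "M = Metric_space.mtopology B d"
    using assms(1) unfolding metrizable_space_def by blast
  then have m: "mtopology_of (metric (B, d)) = M"
    by (simp add: Metric_space.mtopology_of)
  show ?thesis
    by (simp only: uniform_topology_eq[OF m assms(2)] topspace_mtopology_of
        mspace_cfunspace_compact[OF m assms(2)])
qed

lemma compactum_homeomorphic_to_subspace_of_hilbert_cube: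
  fixes K :: "'a topology"
  assumes "compactum K"
  obtains S where "S \<subseteq> topspace hilbert_cube" "compactum (subtopology hilbert_cube S)"
    "K homeomorphic_space subtopology hilbert_cube S"
proof -
  obtain B d where "Metric_space B d" and K: "K = Metric_space.mtopology B d"
    using assms unfolding compactum_def metrizable_space_def by blast
  then interpret Metric_space B d by blast
  have cpt: "compact_space mtopology" using assms by (simp add: compactum_def K)
  then have "mtotally_bounded B"
    using compactin_imp_mtotally_bounded by (simp add: compact_space_def)
  then have "\<exists>F. finite F \<and> F \<subseteq> B \<and> B \<subseteq> (\<Union>x\<in>F. mball x (inverse (Suc n)))" for n
    unfolding mtotally_bounded_def by simp
  then obtain F where F: "\<And>n. finite (F n)" "\<And>n. F n \<subseteq> B"
      "\<And>n. B \<subseteq> (\<Union>x\<in>F n. mball x (inverse (Suc n)))"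
    by metis
  define C where "C = (\<Union>n. F n)"
  have C: "countable C" "C \<subseteq> B"
    using F by (auto simp: C_def intro: countable_finite)
  have dense: "\<exists>c\<in>C. d x c < e" if "x \<in> B" "e > 0" for x e
  proof -
    obtain n where n: "inverse (real (Suc n)) < e" using reals_Archimedean \<open>e > 0\<close> by blast
    obtain c where "c \<in> F n" "x \<in> mball c (inverse (Suc n))" using F(3) \<open>x \<in> B\<close> by blast
    then have "c \<in> C" "d c x < inverse (Suc n)" by (auto simp: C_def)
    then show ?thesis using n commute[of c x] by force
  qed
  define q where "q = from_nat_into C"
  define g where "g = (\<lambda>x n. if C = {} then 0 else min 1 (d x (q n)))"
  have qB: "q n \<in> B" if "C \<noteq> {}" for n
    using that C from_nat_into[of C n] by (auto simp: q_def)
  have contd: "continuous_map mtopology euclideanreal (\<lambda>x. d x a)" if "a \<in> B" for a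
    using that continuous_map_mdist[of mtopology Self "\<lambda>x. x" "\<lambda>x. a"]
    by (simp add: mtopology_of_def)
  have contg: "continuous_map mtopology hilbert_cube g"
    unfolding hilbert_cube_def continuous_map_componentwise_UNIV
  proof
    fix n
    show "continuous_map mtopology (top_of_set {0..1}) (\<lambda>x. g x n)"
      unfolding continuous_map_in_subtopology
      using contd qB by (auto simp: g_def intro!: continuous_map_real_min)
  qed
  have inj: "inj_on g (topspace mtopology)"
  proof (rule inj_onI)
    fix x y assume xy: "x \<in> topspace mtopology" "y \<in> topspace mtopology" "g x = g y"
    show "x = y"
    proof (rule ccontr)
      assume "x \<noteq> y"
      then have pos: "d x y > 0" using xy by auto
      define e where "e = min 1 (d x y / 2)"
      have "e > 0" using pos by (simp add: e_def)
      then obtain c where c: "c \<in> C" "d x c < e" using dense xy by force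
      have "c \<in> B" using c C by blast
      then obtain n where n: "q n = c"
        using from_nat_into_surj[OF C(1)] c(1) unfolding q_def by blast
      have "g x n = g y n" "C \<noteq> {}" using xy c by auto
      then have "min 1 (d x c) = min 1 (d y c)" using n by (simp add: g_def)
      then have "d y c < d x y / 2" "d x c < d x y / 2"
        using c by (auto simp: e_def min_def split: if_splits)
      then show False
        using triangle[of x c y] commute[of c y] xy \<open>c \<in> B\<close> by auto
    qed
  qed
  have "Hausdorff_space hilbert_cube"
    by (simp add: hilbert_cube_def Hausdorff_space_product_topology Hausdorff_space_subtopology)
  then have emb: "embedding_map K hilbert_cube g"
    using contg inj cpt K
    by (simp add: injective_closed_imp_embedding_map T1_Spaces.continuous_imp_closed_map)
  let ?S = "g ` topspace K"
  have hom: "K homeomorphic_space subtopology hilbert_cube ?S"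
    using emb by (rule embedding_map_imp_homeomorphic_space)
  then have "compactum (subtopology hilbert_cube ?S)"
    using assms homeomorphic_compact_space homeomorphic_metrizable_space
    unfolding compactum_def by blast
  moreover have "?S \<subseteq> topspace hilbert_cube"
    using contg K continuous_map_image_subset_topspace by blast
  ultimately show ?thesis using hom that by blast
qed

end

theory Submission
  imports Defs
begin

text \<open>
  Two observations carry the proof. First, being a Krasinkiewicz map is hereditary: if a
  component of a fiber of a map on \<open>K\<close> happens to lie inside a subspace, it is still a component
  of the corresponding fiber of the restricted map, so restrictions of Krasinkiewicz maps to
  compact subspaces are Krasinkiewicz (\<open>krasinkiewicz_map_pullback\<close>). Second, the condition
  \<open>W(f) \<le> \<aleph>\<^sub>0\<close> yields a map \<open>g\<^sub>0\<close> from \<open>X\<close> to the Hilbert cube \<open>Q\<close> that is injective on every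
  fiber of \<open>f\<close>.

  Given \<open>g : X \<rightarrow> M\<close>, the pair \<open>p = (g\<^sub>0, g)\<close> maps \<open>X\<close> into the compactum \<open>Q \<times> M\<close>, embeds every
  fiber of \<open>f\<close>, and satisfies \<open>g = snd \<circ> p\<close>. The projection \<open>snd : Q \<times> M \<rightarrow> M\<close> is uniformly
  approximated by a Krasinkiewicz map \<open>\<phi>\<close>, because \<open>M\<close> is a Krasinkiewicz space; then \<open>\<phi> \<circ> p\<close>
  is just as close to \<open>g\<close>, and by heredity it is Krasinkiewicz on each fiber of \<open>f\<close>. All fibers
  are thus treated at once by one approximation on a single compactum.
\<close>

text \<open>
  Neighbourhoods in the uniform topology are governed by any single metric compatible with the
  target, so density of a set of maps is uniform approximability in that metric.
\<close>

lemma dense_subset_uniform_topology_iff: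
  assumes m: "mtopology_of m = M" and cpt: "compact_space X \<or> compact_space M"
  shows "dense_subset (uniform_topology X M) D \<longleftrightarrow>
           D \<subseteq> topspace (uniform_topology X M) \<and>
           (\<forall>g \<in> topspace (uniform_topology X M). \<forall>e>0. \<exists>h\<in>D.
              \<forall>x\<in>topspace X. mdist m (g x) (h x) < e)"
    (is "_ \<longleftrightarrow> _ \<and> ?approx")
proof -
  let ?P = "cfunspace X m"
  interpret P: Metric_space "mspace ?P" "mdist ?P" by blast
  have T: "uniform_topology X M = P.mtopology"
    by (simp only: uniform_topology_eq[OF m cpt] mtopology_of_def)
  have near: "(\<exists>h\<in>D. h \<in> P.mball g e) \<Longrightarrow> \<exists>h\<in>D. \<forall>x\<in>topspace X. mdist m (g x) (h x) < e"
    if "g \<in> mspace ?P" for g e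
  proof -
    assume "\<exists>h\<in>D. h \<in> P.mball g e"
    then obtain h where h: "h \<in> D" "h \<in> mspace ?P" "mdist ?P g h < e"
      unfolding P.in_mball by blast
    have "mdist m (g x) (h x) < e" if x: "x \<in> topspace X" for x
      using mdist_cfunspace_imp_mdist_le[OF \<open>g \<in> mspace ?P\<close> h(2) order_refl x] h(3) by linarith
    then show ?thesis using h(1) by blast
  qed
  have ball: "\<exists>h\<in>D. h \<in> P.mball g e"
    if "g \<in> mspace ?P" "D \<subseteq> mspace ?P" "e > 0"
      "\<exists>h\<in>D. \<forall>x\<in>topspace X. mdist m (g x) (h x) < e/2" for g e
  proof -
    from that(4) obtain h where h: "h \<in> D" "\<forall>x\<in>topspace X. mdist m (g x) (h x) < e/2"
      by blast
    have "mdist ?P g h \<le> e/2"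
      using h(2) \<open>e > 0\<close> by (intro mdist_cfunspace_le) (auto intro: less_imp_le)
    then have "mdist ?P g h < e" using \<open>e > 0\<close> by linarith
    moreover have "h \<in> mspace ?P" using h(1) that(2) by blast
    ultimately show ?thesis using h(1) that(1) unfolding P.in_mball by blast
  qed
  have "P.mtopology closure_of D = mspace ?P \<longleftrightarrow>
        (\<forall>g\<in>mspace ?P. \<forall>e>0. \<exists>h\<in>D. \<forall>x\<in>topspace X. mdist m (g x) (h x) < e)"
    if D: "D \<subseteq> mspace ?P"
  proof -
    have "P.mtopology closure_of D = mspace ?P \<longleftrightarrow>
          (\<forall>g\<in>mspace ?P. \<forall>e>0. \<exists>h\<in>D. h \<in> P.mball g e)"
      unfolding P.metric_closure_of by blast
    also have "\<dots> \<longleftrightarrow> (\<forall>g\<in>mspace ?P. \<forall>e>0. \<exists>h\<in>D. \<forall>x\<in>topspace X. mdist m (g x) (h x) < e)"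
    proof (intro ball_cong refl iffI allI impI)
      fix g and e :: real
      assume g: "g \<in> mspace ?P" and "e > 0"
      show "\<exists>h\<in>D. \<forall>x\<in>topspace X. mdist m (g x) (h x) < e"
        if "\<forall>e>0. \<exists>h\<in>D. h \<in> P.mball g e"
        using near[OF g] that \<open>e > 0\<close> by blast
      show "\<exists>h\<in>D. h \<in> P.mball g e"
        if "\<forall>e>0. \<exists>h\<in>D. \<forall>x\<in>topspace X. mdist m (g x) (h x) < e"
        using ball[OF g D \<open>e > 0\<close>] that \<open>e > 0\<close> half_gt_zero by blast
    qed
    finally show ?thesis .
  qed
  then show ?thesis
    unfolding dense_subset_def T P.topspace_mtopology by blast
qed

text \<open>
  The type of the domain in \<^const>\<open>krasinkiewicz_space\<close> is fixed, so heredity is stated for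
  injections instead of inclusions: this covers restriction to a compact subspace and transport
  along a homeomorphism in one statement. Metrizability of \<open>K\<close> makes the injection an embedding
  and the image of a continuum a continuum.
\<close>

lemma krasinkiewicz_map_pullback:
  assumes \<phi>: "krasinkiewicz_map K M \<phi>" and K: "metrizable_space K"
    and F: "compact_space F" and q: "continuous_map F K q" and inj: "inj_on q (topspace F)"
    and h: "\<And>x. x \<in> topspace F \<Longrightarrow> h x = \<phi> (q x)"
  shows "krasinkiewicz_map F M h"
  unfolding krasinkiewicz_map_def
proof (intro conjI allI impI)
  show "compact_space F" by (rule F)
  have "continuous_map F M (\<phi> \<circ> q)"
    using \<phi> q continuous_map_compose unfolding krasinkiewicz_map_def by blast
  then show "continuous_map F M h" by (rule continuous_map_eq) (simp add: h)
next
  fix C assume C: "continuum_in F C"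
  have emb: "embedding_map F K q"
    using q inj F K
    by (simp add: injective_closed_imp_embedding_map T1_Spaces.continuous_imp_closed_map
        metrizable_imp_Hausdorff_space)
  have qK: "q x \<in> topspace K" if "x \<in> topspace F" for x
    using q that by (auto simp: continuous_map_def)
  have CF: "C \<subseteq> topspace F" using C by (simp add: continuum_in_def)
  have "compactin F C"
    using C by (simp add: continuum_in_def compactum_def compactin_subspace)
  then have "compactin K (q ` C)" using q image_compactin by blast
  then have "continuum_in K (q ` C)"
    using C qK K q
    by (auto simp: continuum_in_def compactum_def compactin_subspace
        intro: connectedin_continuous_map_image metrizable_space_subtopology)
  then consider (fiber) y where "y \<in> topspace M" "q ` C \<subseteq> fiber K \<phi> y"
    | (component) y D where "y \<in> topspace M"
        "D \<in> connected_components_of (subtopology K (fiber K \<phi> y))" "D \<subseteq> q ` C"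
    using \<phi> unfolding krasinkiewicz_map_def by blast
  then show "(\<exists>y\<in>topspace M. C \<subseteq> fiber F h y) \<or>
        (\<exists>y\<in>topspace M. \<exists>D\<in>connected_components_of (subtopology F (fiber F h y)). D \<subseteq> C)"
  proof cases
    case fiber
    then have "C \<subseteq> fiber F h y" using CF h by (auto simp: fiber_def)
    then show ?thesis using fiber by blast
  next
    case component
    define D' where "D' = {x \<in> C. q x \<in> D}"
    have qD': "q ` D' = D" using component by (auto simp: D'_def)
    have D'F: "D' \<subseteq> topspace F" using CF by (auto simp: D'_def)
    have Dfib: "D \<subseteq> fiber K \<phi> y" and Dne: "D \<noteq> {}" and Dconn: "connectedin K D"
      using component connected_components_of_subset[OF component(2)]
        nonempty_connected_components_of[OF component(2)]
        connectedin_connected_components_of[OF component(2)]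
      by (auto simp: connectedin_subtopology)
    have "homeomorphic_map F (subtopology K (q ` topspace F)) q"
      using emb by (simp add: embedding_map_def)
    moreover have "connectedin (subtopology K (q ` topspace F)) (q ` D')"
      using Dconn qD' D'F by (auto simp: connectedin_subtopology)
    ultimately have D'conn: "connectedin F D'"
      using homeomorphic_map_connectedness[OF _ D'F] by blast
    have D'fib: "D' \<subseteq> fiber F h y"
      using Dfib D'F h by (auto simp: D'_def fiber_def)
    obtain x where x: "x \<in> D'" using Dne qD' by blast
    let ?E = "connected_component_of_set (subtopology F (fiber F h y)) x"
    have "connectedin (subtopology F (fiber F h y)) D'"
      using D'conn D'fib by (simp add: connectedin_subtopology)
    then have "D' \<subseteq> ?E" using x by (simp add: connected_component_of_maximal)
    have E: "connectedin F ?E" "?E \<subseteq> fiber F h y"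
      using connectedin_connected_component_of[of "subtopology F (fiber F h y)" x]
      by (auto simp: connectedin_subtopology)
    have Dx: "q x \<in> D" "x \<in> topspace F" using x D'F by (auto simp: D'_def)
    have xE: "x \<in> ?E" using \<open>D' \<subseteq> ?E\<close> x by blast
    have "connectedin (subtopology K (fiber K \<phi> y)) (q ` ?E)"
      using E(2) qK h connectedin_continuous_map_image[OF q E(1)]
      by (auto simp: connectedin_subtopology fiber_def)
    \<comment> \<open>Maximality of the component \<open>D\<close>: the component of \<open>x\<close> in the smaller fiber may be larger
      than \<open>D'\<close> a priori, but its \<open>q\<close>-image meets \<open>D\<close> and cannot leave it.\<close>
    then have E_sub: "q ` ?E \<subseteq> D"
    proof (rule connected_components_of_maximal[OF component(2)])
      show "\<not> disjnt D (q ` ?E)"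
        unfolding disjnt_iff using Dx(1) imageI[OF xE, of q] by blast
    qed
    have "?E \<subseteq> C"
    proof
      fix z assume z: "z \<in> ?E"
      then obtain c where c: "c \<in> C" "q z = q c" using E_sub component(3) by blast
      have "z \<in> topspace F" using E(2) z by (auto simp: fiber_def)
      then have "z = c" using inj_onD[OF inj c(2)] c(1) CF by blast
      then show "z \<in> C" using c(1) by simp
    qed
    moreover have "?E \<in> connected_components_of (subtopology F (fiber F h y))"
      using D'fib x Dx(2) by (auto simp: connected_components_of_def)
    ultimately show ?thesis using component(1) by blast
  qed
qed

text \<open>
  Passing to a homeomorphic copy in the Hilbert cube makes the defining property of a
  Krasinkiewicz space available for compacta over an arbitrary type.
\<close>

lemma krasinkiewicz_space_approximation:
  fixes K :: "'a topology"
  assumes M: "krasinkiewicz_space M" and m: "mtopology_of m = M"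
    and K: "compactum K" and u: "continuous_map K M u" and "e > 0"
  obtains \<phi> where "krasinkiewicz_map K M \<phi>"
    "\<And>x. x \<in> topspace K \<Longrightarrow> mdist m (u x) (\<phi> x) < e"
proof -
  obtain S where S: "compactum (subtopology hilbert_cube S)"
    "K homeomorphic_space subtopology hilbert_cube S"
    using compactum_homeomorphic_to_subspace_of_hilbert_cube[OF K] by metis
  let ?S = "subtopology hilbert_cube S"
  obtain i j where ij: "homeomorphic_maps K ?S i j"
    using S(2) unfolding homeomorphic_space_def by blast
  then have i: "continuous_map K ?S i" and j: "continuous_map ?S K j"
    and ji: "\<And>x. x \<in> topspace K \<Longrightarrow> j (i x) = x"
    by (auto simp: homeomorphic_maps_def)
  obtain D where D: "dense_subset (uniform_topology ?S M) D" "\<forall>g\<in>D. krasinkiewicz_map ?S M g"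
    using M S(1) unfolding krasinkiewicz_space_def by blast
  have cS: "compact_space ?S \<or> compact_space M" using S(1) by (simp add: compactum_def)
  have Mm: "metrizable_space M" using M by (simp add: krasinkiewicz_space_def)
  define v where "v = restrict (u \<circ> j) (topspace ?S)"
  have "continuous_map ?S M (u \<circ> j)" using j u continuous_map_compose by blast
  then have "continuous_map ?S M v"
    by (rule continuous_map_eq) (simp add: v_def)
  moreover have "v \<in> extensional (topspace ?S)"
    unfolding v_def by (rule restrict_extensional)
  ultimately have "v \<in> topspace (uniform_topology ?S M)"
    unfolding topspace_uniform_topology[OF Mm cS] by blast
  then obtain \<psi> where \<psi>: "\<psi> \<in> D" "\<forall>s\<in>topspace ?S. mdist m (v s) (\<psi> s) < e"
    using D(1) \<open>e > 0\<close> unfolding dense_subset_uniform_topology_iff[OF m cS] by blast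
  have iS: "i x \<in> topspace ?S" if "x \<in> topspace K" for x
    using i that by (meson continuous_map_image_subset_topspace image_subset_iff)
  show ?thesis
  proof
    show "krasinkiewicz_map K M (\<psi> \<circ> i)"
    proof (rule krasinkiewicz_map_pullback)
      show "krasinkiewicz_map ?S M \<psi>" using D(2) \<psi>(1) by blast
      show "metrizable_space ?S" "compact_space K"
        using S(1) K by (simp_all only: compactum_def)
      show "continuous_map K ?S i" by (rule i)
      show "inj_on i (topspace K)" by (metis inj_onI ji)
    qed simp
    show "mdist m (u x) ((\<psi> \<circ> i) x) < e" if "x \<in> topspace K" for x
      using bspec[OF \<psi>(2) iS[OF that]] iS[OF that] ji[OF that] by (simp add: v_def)
  qed
qed

lemma compactum_hilbert_cube: "compactum hilbert_cube"
proof -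
  have "compact_space (top_of_set {0..1::real})"
    by (simp add: compact_space_subtopology)
  moreover have "metrizable_space (top_of_set {0..1::real})"
    by (intro metrizable_space_subtopology metrizable_space_euclidean)
  ultimately show ?thesis
    unfolding compactum_def hilbert_cube_def
    by (auto simp: compact_space_product_topology metrizable_space_product_topology)
qed

theorem theorem1p3:
  fixes X :: "'a topology" and Y :: "'b topology" and M :: "'c topology" and f :: "'a \<Rightarrow> 'b"
  assumes "paracompact_space X" and "Hausdorff_space X"
    and "paracompact_space Y" and "Hausdorff_space Y"
    and "continuous_map X Y f"
    and "\<And>y. y \<in> topspace Y \<Longrightarrow> compactin X (fiber X f y)"
    and "W_le_aleph0 X Y f"
    and "compact_space M" and "metrizable_space M" and "krasinkiewicz_space M"
  shows "\<exists>D. dense_subset (uniform_topology X M) D \<and>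
           (\<forall>g\<in>D. \<forall>y\<in>topspace Y. krasinkiewicz_map (subtopology X (fiber X f y)) M g)"
proof -
  obtain B d where "Metric_space B d" "M = Metric_space.mtopology B d"
    using \<open>metrizable_space M\<close> unfolding metrizable_space_def by blast
  then have m: "mtopology_of (metric (B, d)) = M"
    by (simp add: Metric_space.mtopology_of)
  let ?m = "metric (B, d)"
  have cpt: "compact_space X \<or> compact_space M" using \<open>compact_space M\<close> by blast
  note top = topspace_uniform_topology[OF \<open>metrizable_space M\<close> cpt]
  obtain g0 where g0: "continuous_map X hilbert_cube g0"
    and "embedding_map X (prod_topology Y hilbert_cube) (\<lambda>x. (f x, g0 x))"
    using \<open>W_le_aleph0 X Y f\<close> unfolding W_le_aleph0_def by blast
  then have inj: "inj_on (\<lambda>x. (f x, g0 x)) (topspace X)"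
    by (simp add: embedding_map_def homeomorphic_imp_injective_map)
  let ?K = "prod_topology hilbert_cube M"
  have K: "compactum ?K"
    using compactum_hilbert_cube \<open>compact_space M\<close> \<open>metrizable_space M\<close>
    by (simp add: compactum_def compact_space_prod_topology metrizable_space_prod_topology)
  define D where "D = {h \<in> topspace (uniform_topology X M).
      \<forall>y\<in>topspace Y. krasinkiewicz_map (subtopology X (fiber X f y)) M h}"
  have "\<exists>h\<in>D. \<forall>x\<in>topspace X. mdist ?m (g x) (h x) < e"
    if g: "g \<in> topspace (uniform_topology X M)" and "e > 0" for g e
  proof -
    have "continuous_map X M g" using g unfolding top by blast
    then have p: "continuous_map X ?K (\<lambda>x. (g0 x, g x))"
      using g0 by (simp add: continuous_map_paired)
    then have pK: "(g0 x, g x) \<in> topspace ?K" if "x \<in> topspace X" for x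
      using that by (auto simp: continuous_map_def)
    obtain \<phi> where \<phi>: "krasinkiewicz_map ?K M \<phi>"
      "\<And>z. z \<in> topspace ?K \<Longrightarrow> mdist ?m (snd z) (\<phi> z) < e"
      using krasinkiewicz_space_approximation
        [OF \<open>krasinkiewicz_space M\<close> m K continuous_map_snd \<open>e > 0\<close>] by blast
    define h where "h = restrict (\<lambda>x. \<phi> (g0 x, g x)) (topspace X)"
    have "continuous_map X M (\<phi> \<circ> (\<lambda>x. (g0 x, g x)))"
      using p \<phi>(1) continuous_map_compose unfolding krasinkiewicz_map_def by blast
    then have "continuous_map X M h"
      by (rule continuous_map_eq) (simp add: h_def)
    moreover have "h \<in> extensional (topspace X)"
      unfolding h_def by (rule restrict_extensional)
    ultimately have "h \<in> topspace (uniform_topology X M)" unfolding top by blast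
    moreover have "krasinkiewicz_map (subtopology X (fiber X f y)) M h"
      if y: "y \<in> topspace Y" for y
    proof (rule krasinkiewicz_map_pullback[OF \<phi>(1)])
      show "metrizable_space ?K" using K unfolding compactum_def by blast
      show "compact_space (subtopology X (fiber X f y))"
        using assms(6)[OF y] by (rule compact_space_subtopology)
      show "continuous_map (subtopology X (fiber X f y)) ?K (\<lambda>x. (g0 x, g x))"
        using p by (rule continuous_map_from_subtopology)
      show "inj_on (\<lambda>x. (g0 x, g x)) (topspace (subtopology X (fiber X f y)))"
        using inj by (auto simp: inj_on_def fiber_def)
    qed (simp add: h_def)
    ultimately have "h \<in> D" by (simp add: D_def)
    moreover have "mdist ?m (g x) (h x) < e" if "x \<in> topspace X" for x
      using \<phi>(2)[OF pK[OF that]] that by (simp add: h_def)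
    ultimately show ?thesis by blast
  qed
  moreover have "D \<subseteq> topspace (uniform_topology X M)" by (auto simp: D_def)
  ultimately have "dense_subset (uniform_topology X M) D"
    unfolding dense_subset_uniform_topology_iff[OF m cpt] by blast
  then show ?thesis by (auto simp: D_def)
qed

end
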